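(* Let $F_1,F_2:\mathbb{R}^3\to\mathbb{R}$ be smooth functions, and let the set $\mathcal{L}_{\mathrm{EP}}\subset\mathbb{R}^3$ be locally defined by $F_1(\mathbf{p})=0$, $F_2(\mathbf{p})=0$. Let $\mathbf{p}_0\in\mathcal{L}_{\mathrm{EP}}$ be a point at which the gradients $\nabla F_1(\mathbf{p}_0)$ and $\nabla F_2(\mathbf{p}_0)$ are linearly independent. Define the real symmetric $3\times 3$ matrix $$\mathbf{K}=\nabla F_1\,\nabla F_1^{\mathrm{T}}+\nabla F_2\,\nabla F_2^{\mathrm{T}},$$ with all gradients evaluated at $\mathbf{p}_0$, and for every unit vector $\widehat{\mathbf{u}}\in\mathbb{R}^3$ define $$C_{\widehat{\mathbf{u}}}=\big(\widehat{\mathbf{u}}^{\mathrm{T}}\mathbf{K}\,\widehat{\mathbf{u}}\big)^{1/4}.$$ Let $\mathbf{T}$ be the unit tangent vector of $\mathcal{L}_{\mathrm{EP}}$ at $\mathbf{p}_0$. Then every unit vector $\widehat{\mathbf{u}}_{\max}$ maximizing $C_{\widehat{\mathbf{u}}}$ over all unit vectors satisfies $\widehat{\mathbf{u}}_{\max}\cdot\mathbf{T}=0$; that is, it lies in the normal plane of $\mathcal{L}_{\mathrm{EP}}$ at $\mathbf{p}_0$. Moreover, if $\lambda_+$ denotes the largest eigenvalue of $\mathbf{K}$, then $$C_{\max}:=\max_{\|\widehat{\mathbf{u}}\|=1}C_{\widehat{\mathbf{u}}}=\lambda_+^{1/4},$$ and $\widehat{\mathbf{u}}_{\max}$ is a normalized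 eigenvector of $\mathbf{K}$ corresponding to $\lambda_+$.
   Context: Gradients are column vectors in $\mathbb{R}^3$, so $\nabla F_i\nabla F_i^{\mathrm{T}}$ is a rank-one $3\times3$ matrix; $\|\cdot\|$ is the Euclidean norm. The set $\mathcal{L}_{\mathrm{EP}}$ is called the exceptional line, and near $\mathbf{p}_0$ it is a smooth curve with unit tangent vector at $\mathbf{p}_0$ (up to sign) $$\mathbf{T}=\frac{\nabla F_1\times\nabla F_2}{\|\nabla F_1\times\nabla F_2\|}.$$ The number $C_{\widehat{\mathbf{u}}}$ is called the directional spectral sensitivity coefficient. *)

theory Defs
  imports "HOL-Analysis.Analysis"
begin

(* The i-th partial derivative is the Frechet derivative in the direction of the i-th
   standard basis vector. *)
primrec k_times_cont_diff :: "nat \<Rightarrow> (real^'n \<Rightarrow> real) \<Rightarrow> bool" where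
  "k_times_cont_diff 0 f \<longleftrightarrow> continuous_on UNIV f"
| "k_times_cont_diff (Suc k) f \<longleftrightarrow>
     (\<forall>x. f differentiable (at x)) \<and>
     (\<forall>i. k_times_cont_diff k (\<lambda>x. frechet_derivative f (at x) (axis i 1)))"

definition smooth :: "(real^'n \<Rightarrow> real) \<Rightarrow> bool" where
  "smooth f \<longleftrightarrow> (\<forall>k. k_times_cont_diff k f)"

definition gradient :: "(real^'n \<Rightarrow> real) \<Rightarrow> real^'n \<Rightarrow> real^'n" where
  "gradient f x = (THE D. GDERIV f x :> D)"

(* Velocities of curves running inside S. Differentiability of the curve at the single
   parameter 0 suffices here: where S is a smooth curve, smooth parametrisations give the
   same vectors; see unit_tangent_vector_iff_cross3 for existence and the explicit form. *)
definition tangent_vector :: "(real^'n) set \<Rightarrow> real^'n \<Rightarrow> real^'n \<Rightarrow> bool" where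
  "tangent_vector S p v \<longleftrightarrow>
     (\<exists>\<gamma>. \<gamma> 0 = p \<and> (\<forall>\<^sub>F t in nhds 0. \<gamma> t \<in> S) \<and> (\<gamma> has_vector_derivative v) (at 0))"

definition unit_tangent_vector :: "(real^'n) set \<Rightarrow> real^'n \<Rightarrow> real^'n \<Rightarrow> bool" where
  "unit_tangent_vector S p T \<longleftrightarrow> norm T = 1 \<and> tangent_vector S p T"

(* The plane of normal directions, as a linear subspace (not translated to p). *)
definition normal_plane :: "(real^'n) set \<Rightarrow> real^'n \<Rightarrow> (real^'n) set" where
  "normal_plane S p = {w. \<forall>v. tangent_vector S p v \<longrightarrow> w \<bullet> v = 0}"

definition sensitivity_matrix :: "(real^3 \<Rightarrow> real) \<Rightarrow> (real^3 \<Rightarrow> real) \<Rightarrow> real^3 \<Rightarrow> real^3^3" where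
  "sensitivity_matrix F1 F2 p =
     (columnvector (gradient F1 p) :: real^1^3) ** transpose (columnvector (gradient F1 p)) +
     (columnvector (gradient F2 p) :: real^1^3) ** transpose (columnvector (gradient F2 p))"

definition sensitivity_coeff :: "real^3^3 \<Rightarrow> real^3 \<Rightarrow> real" where
  "sensitivity_coeff K u = root 4 (u \<bullet> (K *v u))"

definition eigenvector :: "real^'n^'n \<Rightarrow> real^'n \<Rightarrow> real \<Rightarrow> bool" where
  "eigenvector A v c \<longleftrightarrow> v \<noteq> 0 \<and> A *v v = c *\<^sub>R v"

definition eigenvalue :: "real^'n^'n \<Rightarrow> real \<Rightarrow> bool" where
  "eigenvalue A c \<longleftrightarrow> (\<exists>v. eigenvector A v c)"

definition largest_eigenvalue :: "real^'n^'n \<Rightarrow> real" where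
  "largest_eigenvalue A = (GREATEST c. eigenvalue A c)"

lemma GDERIV_gradient:
  assumes "f differentiable (at x)"
  shows "GDERIV f x :> gradient f x"
proof -
  let ?f' = "frechet_derivative f (at x)"
  have d: "(f has_derivative ?f') (at x)"
    using assms frechet_derivative_works by blast
  then have lin: "linear ?f'" by (rule has_derivative_linear)
  have eq: "?f' = (\<lambda>h. h \<bullet> adjoint ?f' 1)"
    using adjoint_works[OF lin, of _ 1] by (simp add: fun_eq_iff)
  then have ex: "GDERIV f x :> adjoint ?f' 1"
    unfolding gderiv_def using d by simp
  have uniq: "D = adjoint ?f' 1" if "GDERIV f x :> D" for D
  proof -
    have "(\<lambda>h. h \<bullet> D) = (\<lambda>h. h \<bullet> adjoint ?f' 1)"
      using that ex unfolding gderiv_def by (rule has_derivative_unique)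
    then have "\<forall>h. h \<bullet> D = h \<bullet> adjoint ?f' 1" by (simp add: fun_eq_iff)
    then show ?thesis by (simp only: vector_eq_ldot)
  qed
  have "gradient f x = adjoint ?f' 1"
    unfolding gradient_def
  proof (rule the_equality)
    show "GDERIV f x :> adjoint ?f' 1" by (fact ex)
    show "D = adjoint ?f' 1" if "GDERIV f x :> D" for D
      using that by (rule uniq)
  qed
  then show ?thesis using ex by simp
qed

lemma smooth_differentiable: "smooth f \<Longrightarrow> f differentiable (at x)"
  unfolding smooth_def by (drule spec[of _ "Suc 0"]) simp

lemma gradient_nth:
  assumes "f differentiable (at x)"
  shows "gradient f x $ i = frechet_derivative f (at x) (axis i 1)"
proof -
  have "(f has_derivative (\<lambda>h. h \<bullet> gradient f x)) (at x)"
    using GDERIV_gradient[OF assms] unfolding gderiv_def .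
  then have "frechet_derivative f (at x) = (\<lambda>h. h \<bullet> gradient f x)"
    by (rule frechet_derivative_at[symmetric])
  then show ?thesis by (simp add: inner_axis')
qed

lemma continuous_on_gradient:
  fixes f :: "real^'n \<Rightarrow> real"
  assumes "smooth f"
  shows "continuous_on UNIV (gradient f)"
proof -
  have "continuous_on UNIV (\<lambda>x. frechet_derivative f (at x) (axis i 1))" for i
    using assms unfolding smooth_def by (drule_tac spec[of _ "Suc 0"]) simp
  then have "continuous_on UNIV (\<lambda>x. gradient f x $ i)" for i
    using gradient_nth[OF smooth_differentiable[OF assms]] by simp
  then have "continuous_on UNIV (\<lambda>x. \<chi> i. gradient f x $ i)"
    by (intro continuous_on_vec_lambda)
  then show ?thesis by simp
qed

lemma tangent_vector_orthogonal_gradient: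
  assumes "tangent_vector L p v" "open U" "p \<in> U" "\<And>q. q \<in> L \<inter> U \<Longrightarrow> F q = 0"
    and "smooth F"
  shows "v \<bullet> gradient F p = 0"
proof -
  obtain \<gamma> where g: "\<gamma> 0 = p" "\<forall>\<^sub>F t in nhds 0. \<gamma> t \<in> L" "(\<gamma> has_vector_derivative v) (at 0)"
    using assms(1) unfolding tangent_vector_def by blast
  have dg: "(\<gamma> has_derivative (\<lambda>t. t *\<^sub>R v)) (at 0)"
    using g(3) unfolding has_vector_derivative_def .
  have "isCont \<gamma> 0" using dg has_derivative_continuous by blast
  then have "\<forall>\<^sub>F t in at 0. \<gamma> t \<in> U"
    unfolding isCont_def using topological_tendstoD assms(2,3) g(1) by blast
  then have "\<forall>\<^sub>F t in nhds 0. \<gamma> t \<in> U"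
    using assms(3) g(1) by (simp add: eventually_nhds_conv_at)
  with g(2) have "\<forall>\<^sub>F t in nhds 0. F (\<gamma> t) = 0"
    by eventually_elim (use assms(4) in blast)
  then obtain S where S: "open S" "0 \<in> S" "\<And>t. t \<in> S \<Longrightarrow> F (\<gamma> t) = 0"
    unfolding eventually_nhds by blast
  have "(F has_derivative (\<lambda>h. h \<bullet> gradient F p)) (at (\<gamma> 0))"
    using GDERIV_gradient[OF smooth_differentiable[OF assms(5)], of p] g(1)
    unfolding gderiv_def by simp
  from has_derivative_compose[OF dg this]
  have 1: "((\<lambda>t. F (\<gamma> t)) has_derivative (\<lambda>t. (t *\<^sub>R v) \<bullet> gradient F p)) (at 0)" .
  have "((\<lambda>t. F (\<gamma> t)) has_derivative (\<lambda>t. 0)) (at 0)"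
    by (rule has_derivative_transform_within_open[of "\<lambda>t. 0" _ _ _ S]) (use S in auto)
  with 1 have "(\<lambda>t::real. (t *\<^sub>R v) \<bullet> gradient F p) = (\<lambda>t. 0)"
    by (rule has_derivative_unique)
  from fun_cong[OF this, of 1] show ?thesis by simp
qed

lemma cross3_nonzero:
  fixes a b :: "real^3"
  assumes "a \<noteq> b" "independent {a, b}"
  shows "cross3 a b \<noteq> 0"
proof
  assume "cross3 a b = 0"
  then have "collinear {0, a, b}" by (simp add: cross_eq_0)
  then consider "a = 0" | "b = 0" | c where "b = c *\<^sub>R a"
    unfolding collinear_lemma by blast
  then show False
  proof cases
    case 3
    then have "b \<in> span ({a, b} - {b})"
      using assms(1) by (auto simp: insert_Diff_if span_base span_scale)
    then show False using assms(2) unfolding dependent_def by blast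
  qed (use assms(2) dependent_zero in auto)
qed

lemma tangent_vector_cross3:
  fixes F1 F2 :: "real^3 \<Rightarrow> real"
  assumes "smooth F1" "smooth F2" "open U" "p \<in> U"
    and L: "L \<inter> U = {q \<in> U. F1 q = 0 \<and> F2 q = 0}" and "p \<in> L"
    and nz: "cross3 (gradient F1 p) (gradient F2 p) \<noteq> 0"
  shows "tangent_vector L p (c *\<^sub>R cross3 (gradient F1 p) (gradient F2 p))"
proof -
  define a b n where "a = gradient F1 p" and "b = gradient F2 p" and "n = cross3 a b"
  define f where "f x = F1 x *\<^sub>R a + F2 x *\<^sub>R b + ((x - p) \<bullet> n) *\<^sub>R n" for x
  define D where "D x h = (h \<bullet> gradient F1 x) *\<^sub>R a + (h \<bullet> gradient F2 x) *\<^sub>R b + (h \<bullet> n) *\<^sub>R n" for x h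
  have n0: "n \<noteq> 0" using nz by (simp add: n_def a_def b_def)
  have an: "a \<bullet> n = 0" "b \<bullet> n = 0" by (simp_all add: n_def dot_cross_self)
  have coeffs: "r = 0 \<and> s = 0" if "r *\<^sub>R a + s *\<^sub>R b = 0" for r s
  proof -
    have "cross3 (r *\<^sub>R a + s *\<^sub>R b) b = r *\<^sub>R n" "cross3 a (r *\<^sub>R a + s *\<^sub>R b) = s *\<^sub>R n"
      by (simp_all add: n_def cross_add_left cross_add_right cross_mult_left cross_mult_right)
    then have "r *\<^sub>R n = 0" "s *\<^sub>R n = 0"
      using that by (simp_all only: cross_zero_left cross_zero_right)
    then show ?thesis using n0 by (simp only: scaleR_eq_0_iff simp_thms)
  qed
  have coeffs3: "r = 0 \<and> s = 0 \<and> t = 0" if "r *\<^sub>R a + s *\<^sub>R b + t *\<^sub>R n = 0" for r s t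
  proof -
    have "(r *\<^sub>R a + s *\<^sub>R b + t *\<^sub>R n) \<bullet> n = t * (n \<bullet> n)"
      by (simp add: inner_add_left an)
    then have "t = 0" using that n0 by simp
    then show ?thesis using coeffs that by simp
  qed
  have blD: "bounded_linear (D x)" for x
    unfolding D_def by (intro bounded_linear_intros)
  have df1: "(F1 has_derivative (\<lambda>h. h \<bullet> gradient F1 x)) (at x)" for x
    using GDERIV_gradient[OF smooth_differentiable[OF assms(1)]] unfolding gderiv_def .
  have df2: "(F2 has_derivative (\<lambda>h. h \<bullet> gradient F2 x)) (at x)" for x
    using GDERIV_gradient[OF smooth_differentiable[OF assms(2)]] unfolding gderiv_def .
  have df: "(f has_derivative D x) (at x)" for x
    unfolding f_def D_def
    by (rule derivative_eq_intros df1 df2 refl | simp)+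
  define f' where "f' x = Blinfun (D x)" for x
  have f': "blinfun_apply (f' x) = D x" for x
    unfolding f'_def by (rule bounded_linear_Blinfun_apply[OF blD])
  have cf': "continuous_on U f'"
  proof (rule continuous_on_blinfun_componentwise)
    have c: "continuous_on U (gradient F1)" "continuous_on U (gradient F2)"
      using continuous_on_gradient assms(1,2) continuous_on_subset by blast+
    show "continuous_on U (\<lambda>x. blinfun_apply (f' x) i)" for i
      unfolding f' D_def by (intro continuous_intros c)
  qed
  have injD: "inj (D p)"
  proof -
    have "h = 0" if "D p h = 0" for h
    proof -
      have h: "h \<bullet> a = 0" "h \<bullet> b = 0" "h \<bullet> n = 0"
        using coeffs3 that unfolding D_def by (simp_all add: a_def b_def)
      have "cross3 h n = 0" unfolding n_def Lagrange using h by (simp add: inner_commute)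
      then have "norm h * norm n = 0"
        using norm_cross_dot[of h n] h(3) by simp
      then show ?thesis using n0 by simp
    qed
    then show ?thesis
      using linear_injective_0[OF bounded_linear.linear[OF blD]] by blast
  qed
  then obtain G where G: "linear G" "\<And>x. G (D p x) = x" "\<And>x. D p (G x) = x"
    using linear_injective_isomorphism[OF bounded_linear.linear[OF blD]] by metis
  have blG: "bounded_linear G" using G(1) linear_conv_bounded_linear by blast
  have invf: "Blinfun G o\<^sub>L f' p = id_blinfun"
    by (rule blinfun_eqI) (simp add: bounded_linear_Blinfun_apply[OF blG] f' G(2))
  obtain U' V g g' where IF: "open U'" "U' \<subseteq> U" "p \<in> U'" "open V" "f p \<in> V" "homeomorphism U' V f g"
    "\<And>y. y \<in> V \<Longrightarrow> (g has_derivative (g' y)) (at y)"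
    "\<And>y. y \<in> V \<Longrightarrow> g' y = inv (blinfun_apply (f'(g y)))"
    "\<And>y. y \<in> V \<Longrightarrow> bij (blinfun_apply (f'(g y)))"
    using inverse_function_theorem[OF \<open>open U\<close> _ cf' \<open>p \<in> U\<close> invf, of f] df f' by metis
  have pz: "F1 p = 0" "F2 p = 0" using L \<open>p \<in> L\<close> \<open>p \<in> U\<close> by auto
  then have fp: "f p = 0" by (simp add: f_def)
  have gp: "g 0 = p" using IF(3,6) fp unfolding homeomorphism_def by metis
  define w where "w = (c * (n \<bullet> n)) *\<^sub>R n"
  have Dcn: "D p (c *\<^sub>R n) = w"
    using an by (simp add: D_def w_def a_def b_def inner_commute)
  have g0: "(g has_derivative inv (D p)) (at 0)"
    using IF(7,8)[of 0] IF(5) fp gp f' by simp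
  define \<gamma> where "\<gamma> t = g (t *\<^sub>R w)" for t :: real
  have "(\<gamma> has_derivative (\<lambda>t. inv (D p) (t *\<^sub>R w))) (at 0)"
    unfolding \<gamma>_def
    by (rule has_derivative_compose[where g = g]) (auto intro!: derivative_eq_intros simp: g0)
  moreover have "inv (D p) (t *\<^sub>R w) = t *\<^sub>R (c *\<^sub>R n)" for t
  proof -
    have "D p (t *\<^sub>R (c *\<^sub>R n)) = t *\<^sub>R w"
      using Dcn linear_scale[OF bounded_linear.linear[OF blD]] by metis
    then show ?thesis using injD by (metis inv_f_f)
  qed
  ultimately have der: "(\<gamma> has_vector_derivative c *\<^sub>R n) (at 0)"
    unfolding has_vector_derivative_def by simp
  have "open ((\<lambda>t::real. t *\<^sub>R w) -` V)"
    by (intro continuous_open_vimage IF(4)) (auto intro!: continuous_intros)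
  moreover have "0 \<in> (\<lambda>t::real. t *\<^sub>R w) -` V" using IF(5) fp by simp
  moreover have "\<gamma> t \<in> L" if "t *\<^sub>R w \<in> V" for t
  proof -
    have gU: "\<gamma> t \<in> U'" and fg: "f (\<gamma> t) = t *\<^sub>R w"
      using IF(6) that unfolding \<gamma>_def homeomorphism_def by auto
    have "F1 (\<gamma> t) *\<^sub>R a + F2 (\<gamma> t) *\<^sub>R b + ((\<gamma> t - p) \<bullet> n - t * (c * (n \<bullet> n))) *\<^sub>R n = 0"
      using fg unfolding f_def w_def by (simp add: algebra_simps)
    then have "F1 (\<gamma> t) = 0" "F2 (\<gamma> t) = 0" using coeffs3 by blast+
    then show ?thesis using L gU IF(2) by blast
  qed
  ultimately have "\<forall>\<^sub>F t in nhds 0. \<gamma> t \<in> L"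
    unfolding eventually_nhds by blast
  moreover have "\<gamma> 0 = p" by (simp add: \<gamma>_def gp)
  ultimately show ?thesis
    using der unfolding tangent_vector_def n_def a_def b_def by blast
qed

lemma unit_tangent_vector_iff_cross3:
  fixes F1 F2 :: "real^3 \<Rightarrow> real"
  defines "n p \<equiv> cross3 (gradient F1 p) (gradient F2 p)"
  assumes "smooth F1" "smooth F2" "open U" "p \<in> U"
    and L: "L \<inter> U = {q \<in> U. F1 q = 0 \<and> F2 q = 0}" and "p \<in> L"
    and indep: "gradient F1 p \<noteq> gradient F2 p" "independent {gradient F1 p, gradient F2 p}"
  shows "unit_tangent_vector L p T \<longleftrightarrow> T = n p /\<^sub>R norm (n p) \<or> T = - (n p /\<^sub>R norm (n p))"
proof
  have n0: "n p \<noteq> 0" using cross3_nonzero[OF indep] by (simp add: n_def)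
  {
    assume T: "unit_tangent_vector L p T"
    then have tv: "tangent_vector L p T" and nT: "norm T = 1"
      unfolding unit_tangent_vector_def by auto
    have "T \<bullet> gradient F1 p = 0" "T \<bullet> gradient F2 p = 0"
      using tangent_vector_orthogonal_gradient[OF tv assms(4,5)] L assms(2,3) by blast+
    then have "cross3 T (n p) = 0"
      unfolding n_def Lagrange by (simp add: inner_commute)
    then obtain c where c: "n p = c *\<^sub>R T"
      unfolding cross_eq_0 collinear_lemma using n0 nT by (metis norm_zero zero_neq_one scaleR_zero_left)
    with n0 have "c \<noteq> 0" "norm (n p) = \<bar>c\<bar>" using nT by auto
    then show "T = n p /\<^sub>R norm (n p) \<or> T = - (n p /\<^sub>R norm (n p))"
      using c by (cases "c > 0") auto
  }
  {
    assume T: "T = n p /\<^sub>R norm (n p) \<or> T = - (n p /\<^sub>R norm (n p))"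
    then have nT: "norm T = 1"
      using n0 by auto
    have "T = (1 / norm (n p)) *\<^sub>R n p \<or> T = (- 1 / norm (n p)) *\<^sub>R n p"
      using T by (simp add: divide_inverse)
    then obtain c where "T = c *\<^sub>R n p" by blast
    with nT show "unit_tangent_vector L p T"
      unfolding unit_tangent_vector_def
      using tangent_vector_cross3[OF assms(2-5) L \<open>p \<in> L\<close>] n0 unfolding n_def by auto
  }
qed

end

(* A maximiser u of the Rayleigh quotient u . Ku on the unit sphere is an eigenvector for the
   largest eigenvalue M, because M - K is positive semidefinite and its quadratic form vanishes
   at u.  Here Ku = (a . u) a + (b . u) b with a, b the two gradients, and M > 0, so
   u = Ku / M lies in the span of the gradients, which is orthogonal to every tangent vector. *)

theory Submission
  imports Defs
begin

text \<open>Perturb \<open>u\<close> in the direction \<open>B u\<close>: along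
  \<open>u + t *\<^sub>R B u\<close> the form is a quadratic in \<open>t\<close> with no constant
  term and linear coefficient twice the squared norm of \<open>B u\<close>. It stays nonnegative on
  both sides of 0 only if that coefficient vanishes.\<close>

lemma psd_quadratic_form_zero_imp_kernel:
  fixes B :: "'a::real_inner \<Rightarrow> 'a"
  assumes lin: "linear B"
    and sym: "\<And>x y. x \<bullet> B y = y \<bullet> B x"
    and psd: "\<And>x. 0 \<le> x \<bullet> B x"
    and zero: "u \<bullet> B u = 0"
  shows "B u = 0"
proof -
  define s where "s = B u \<bullet> B u"
  define w where "w = B u \<bullet> B (B u)"
  have w: "0 \<le> w" using psd by (simp add: w_def)
  have nonneg: "0 \<le> 2 * t * s + t\<^sup>2 * w" for t
  proof -
    have "u \<bullet> B (B u) = s" by (simp add: s_def sym[of u])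
    then have "(u + t *\<^sub>R B u) \<bullet> B (u + t *\<^sub>R B u) = 2 * t * s + t\<^sup>2 * w"
      by (simp add: linear_add[OF lin] linear_scale[OF lin] inner_add_left inner_add_right
          zero s_def w_def power2_eq_square algebra_simps)
    then show ?thesis using psd by metis
  qed
  \<comment> \<open>The shift by 1 keeps the denominator positive even when \<open>w = 0\<close>. At
    \<open>t = - s / k\<close> the linear term outweighs the quadratic one, and the value is
    negative unless \<open>s = 0\<close>.\<close>
  define k where "k = w + 1"
  have k: "0 < k" using w by (simp add: k_def)
  have "0 \<le> 2 * (- s / k) * s + (- s / k)\<^sup>2 * (k - 1)"
    using nonneg[of "- s / k"] by (simp only: k_def add_diff_cancel_right')
  also have "\<dots> = - (s\<^sup>2 * (k + 1) / k\<^sup>2)"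
    using k by (simp add: field_simps power2_eq_square)
  finally have "s\<^sup>2 * (k + 1) / k\<^sup>2 \<le> 0" by simp
  then have "s = 0" using k by (simp add: divide_le_0_iff mult_le_0_iff)
  then show ?thesis by (simp add: s_def)
qed

text \<open>Both sides are homogeneous of degree two. This turns maximality on the unit sphere into
  semidefiniteness on the whole space.\<close>

lemma quadratic_form_le_norm:
  fixes A :: "real^'n^'n"
  assumes "\<And>v. norm v = 1 \<Longrightarrow> v \<bullet> (A *v v) \<le> M"
  shows "v \<bullet> (A *v v) \<le> M * (v \<bullet> v)"
proof (cases "v = 0")
  case False
  define w where "w = v /\<^sub>R norm v"
  have v: "v = norm v *\<^sub>R w" and "norm w = 1" using False by (simp_all add: w_def)
  have "v \<bullet> (A *v v) = (norm v)\<^sup>2 * (w \<bullet> (A *v w))"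
    by (subst (1 2) v) (simp add: matrix_vector_mult_scaleR power2_eq_square)
  also have "\<dots> \<le> (norm v)\<^sup>2 * M"
    using assms[OF \<open>norm w = 1\<close>] by (simp add: mult_left_mono)
  finally show ?thesis by (simp add: power2_norm_eq_inner mult.commute)
qed simp

lemma rayleigh_maximizer:
  fixes A :: "real^'n^'n"
  assumes sym: "\<And>x y. x \<bullet> (A *v y) = y \<bullet> (A *v x)"
    and u: "norm u = 1"
    and max: "\<And>v. norm v = 1 \<Longrightarrow> v \<bullet> (A *v v) \<le> u \<bullet> (A *v u)"
  shows "largest_eigenvalue A = u \<bullet> (A *v u)" (is "_ = ?M")
    and "eigenvector A u (largest_eigenvalue A)"
proof -
  have uu: "u \<bullet> u = 1" using u by (simp add: norm_eq_1)
  note bound = quadratic_form_le_norm[OF max]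
  have "?M *\<^sub>R u - A *v u = 0"
  proof (rule psd_quadratic_form_zero_imp_kernel[where B = "\<lambda>v. ?M *\<^sub>R v - A *v v"])
    show "linear (\<lambda>v. ?M *\<^sub>R v - A *v v)"
      by (intro linear_compose_sub linear_compose_scale_right linear_ident matrix_vector_mul_linear)
    show "x \<bullet> (?M *\<^sub>R y - A *v y) = y \<bullet> (?M *\<^sub>R x - A *v x)" for x y
      using sym[of x y] by (simp add: inner_diff_right inner_commute)
    show "0 \<le> x \<bullet> (?M *\<^sub>R x - A *v x)" for x
      using bound[of x] by (simp add: inner_diff_right)
    show "u \<bullet> (?M *\<^sub>R u - A *v u) = 0" by (simp add: inner_diff_right uu)
  qed
  then have ev: "eigenvector A u ?M" using u by (auto simp: eigenvector_def)
  show eq: "largest_eigenvalue A = ?M"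
    unfolding largest_eigenvalue_def
  proof (rule Greatest_equality)
    show "eigenvalue A ?M" using ev by (auto simp: eigenvalue_def)
    \<comment> \<open>Pairing \<open>A *v v = c *\<^sub>R v\<close> with \<open>v\<close> gives
      \<open>c * (v \<bullet> v)\<close>, which the homogeneous bound compares with
      \<open>?M * (v \<bullet> v)\<close>.\<close>
    fix c assume "eigenvalue A c"
    then obtain v where "v \<noteq> 0" "A *v v = c *\<^sub>R v" by (auto simp: eigenvalue_def eigenvector_def)
    then show "c \<le> ?M" using bound[of v] by simp
  qed
  show "eigenvector A u (largest_eigenvalue A)" using ev eq by simp
qed

text \<open>\<open>root 4\<close> is strictly increasing on all reals, being extended as an odd
  function to negative arguments, so taking the fourth root leaves the maximisers unchanged for
  every matrix \<open>A\<close>.\<close>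

lemma is_arg_max_sensitivity_coeff_iff:
  "is_arg_max (sensitivity_coeff A) (\<lambda>u. norm u = 1) u \<longleftrightarrow>
     norm u = 1 \<and> (\<forall>v. norm v = 1 \<longrightarrow> v \<bullet> (A *v v) \<le> u \<bullet> (A *v u))"
  by (auto simp: is_arg_max_def sensitivity_coeff_def not_less)

text \<open>The unit sphere is compact and the quadratic form is continuous.\<close>

lemma sensitivity_coeff_arg_max_exists:
  "\<exists>u. is_arg_max (sensitivity_coeff A) (\<lambda>u. norm u = 1) u"
proof -
  have "continuous_on (sphere 0 1) (\<lambda>u. u \<bullet> (A *v u))"
    by (intro continuous_intros linear_continuous_on matrix_vector_mul_bounded_linear)
  then have "\<exists>u\<in>sphere 0 1. \<forall>v\<in>sphere 0 1. v \<bullet> (A *v v) \<le> u \<bullet> (A *v u)"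
    by (intro continuous_attains_sup) auto
  then show ?thesis by (auto simp: is_arg_max_sensitivity_coeff_iff)
qed

text \<open>By associativity the row times \<open>x\<close> comes first, and that 1 by 1 product is
  the scalar \<open>b \<bullet> x\<close>.\<close>

lemma columnvector_mult_transpose_vector:
  fixes a :: "real^'n" and x :: "real^'m"
  shows "((columnvector a :: real^1^'n) ** transpose (columnvector b)) *v x = (b \<bullet> x) *\<^sub>R a"
  by (simp add: vec_eq_iff matrix_vector_mult_def matrix_matrix_mult_def columnvector_def
      transpose_def inner_vec_def sum_distrib_left sum_distrib_right mult_ac)

lemma sensitivity_matrix_vector_mult:
  "sensitivity_matrix F1 F2 p *v x =
     (gradient F1 p \<bullet> x) *\<^sub>R gradient F1 p + (gradient F2 p \<bullet> x) *\<^sub>R gradient F2 p"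
  by (simp add: sensitivity_matrix_def matrix_vector_mult_add_rdistrib
      columnvector_mult_transpose_vector)

theorem theorem1:
  fixes F1 F2 :: "real^3 \<Rightarrow> real" and L U :: "(real^3) set" and p0 T :: "real^3"
    and K :: "real^3^3" and C :: "real^3 \<Rightarrow> real" and lambda_max :: real
  assumes "smooth F1" and "smooth F2"
    and "open U" and "p0 \<in> U" and "L \<inter> U = {p \<in> U. F1 p = 0 \<and> F2 p = 0}"
    and "p0 \<in> L"
    and "gradient F1 p0 \<noteq> gradient F2 p0" and "independent {gradient F1 p0, gradient F2 p0}"
    and "unit_tangent_vector L p0 T"
    and "K = sensitivity_matrix F1 F2 p0"
    and "C = sensitivity_coeff K"
    and "lambda_max = largest_eigenvalue K"
  shows "(\<forall>u. is_arg_max C (\<lambda>u. norm u = 1) u \<longrightarrow>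
            u \<bullet> T = 0 \<and> u \<in> normal_plane L p0 \<and> norm u = 1 \<and> eigenvector K u lambda_max)
       \<and> (\<exists>u. is_arg_max C (\<lambda>u. norm u = 1) u)
       \<and> (SUP u\<in>{u. norm u = 1}. C u) = root 4 lambda_max"
proof -
  define a b where "a = gradient F1 p0" and "b = gradient F2 p0"
  have Kv: "K *v x = (a \<bullet> x) *\<^sub>R a + (b \<bullet> x) *\<^sub>R b" for x
    using assms(10) by (simp add: sensitivity_matrix_vector_mult a_def b_def)
  have sym: "x \<bullet> (K *v y) = y \<bullet> (K *v x)" for x y
    by (simp add: Kv inner_add_right inner_commute mult.commute)
  have "a \<noteq> 0" using assms(8) dependent_zero[of "{a, b}"] by (auto simp: a_def b_def)
  have max: "lambda_max = u \<bullet> (K *v u)" "eigenvector K u lambda_max" "norm u = 1"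
    "\<And>v. norm v = 1 \<Longrightarrow> C v \<le> C u"
    if "is_arg_max C (\<lambda>u. norm u = 1) u" for u
  proof -
    have u: "norm u = 1" "\<And>v. norm v = 1 \<Longrightarrow> v \<bullet> (K *v v) \<le> u \<bullet> (K *v u)"
      using that assms(11) by (auto simp: is_arg_max_sensitivity_coeff_iff)
    show "lambda_max = u \<bullet> (K *v u)" "eigenvector K u lambda_max"
      using rayleigh_maximizer[OF sym u] assms(12) by simp_all
    show "norm u = 1" by (fact u(1))
    show "C v \<le> C u" if "norm v = 1" for v
      using u(2)[OF that] assms(11) by (simp add: sensitivity_coeff_def)
  qed
  \<comment> \<open>Stated for every tangent vector, as \<open>normal_plane\<close> demands;
    \<open>T\<close> is one instance.\<close>
  have tangent: "u \<bullet> v = 0"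
    if u: "is_arg_max C (\<lambda>u. norm u = 1) u" and v: "tangent_vector L p0 v" for u v
  proof -
    have va: "a \<bullet> v = 0" "b \<bullet> v = 0"
      using tangent_vector_orthogonal_gradient[OF v assms(3,4)] assms(1,2,5)
      by (auto simp: a_def b_def inner_commute)
    \<comment> \<open>Positivity of the maximum allows cancelling \<open>lambda_max\<close> below.
      The test vector is \<open>a\<close>, where the form equals
      \<open>(a \<bullet> a)\<^sup>2 + (a \<bullet> b)\<^sup>2\<close>.\<close>
    have "u \<bullet> (K *v u) > 0"
    proof -
      have "a \<bullet> (K *v a) \<le> (u \<bullet> (K *v u)) * (a \<bullet> a)"
        using u assms(11)
        by (intro quadratic_form_le_norm) (auto simp: is_arg_max_sensitivity_coeff_iff)
      moreover have "a \<bullet> (K *v a) > 0"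
        using \<open>a \<noteq> 0\<close>
        by (simp add: Kv inner_add_right inner_commute add_pos_nonneg flip: power2_eq_square)
      ultimately have "0 < (u \<bullet> (K *v u)) * (a \<bullet> a)" by linarith
      then show ?thesis using inner_ge_zero[of a] by (auto simp: zero_less_mult_iff)
    qed
    moreover have "lambda_max * (u \<bullet> v) = (K *v u) \<bullet> v"
      using max(2)[OF u] by (simp add: eigenvector_def)
    moreover have "(K *v u) \<bullet> v = 0" by (simp add: Kv inner_add_left va)
    ultimately show ?thesis using max(1)[OF u] by simp
  qed
  obtain u where u: "is_arg_max C (\<lambda>u. norm u = 1) u"
    using sensitivity_coeff_arg_max_exists[of K] assms(11) by blast
  \<comment> \<open>The supremum is attained at \<open>u\<close>, so it is a genuine
    maximum.\<close>
  have "(SUP u\<in>{u. norm u = 1}. C u) = C u"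
    using max(3,4)[OF u] by (intro cSup_eq_maximum) auto
  also have "C u = root 4 lambda_max"
    using max(1)[OF u] assms(11) by (simp add: sensitivity_coeff_def)
  finally show ?thesis
    using u max(2,3) tangent assms(9) by (auto simp: normal_plane_def unit_tangent_vector_def)
qed

end
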